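(* Let $\lambda,\kappa$ be cardinals. If $\omega\leq\lambda=\lambda^{<\lambda}\leq\kappa$, then the poset $\langle[\kappa]^{<\lambda},\subset\rangle$ is not reversible. Under GCH, the poset $\langle[\kappa]^{<\lambda},\subset\rangle$ is not reversible whenever $\omega\leq\lambda\leq\kappa$ and $\lambda$ is a regular cardinal.
   Context: $[\kappa]^{<\lambda}$ is the set of subsets of $\kappa$ of size less than $\lambda$, and $\subset$ denotes (not necessarily proper) inclusion. $\lambda^{<\lambda}=|\bigcup_{\alpha<\lambda}{}^{\alpha}\lambda|$ is the usual weak power. A poset $\langle P,\leq\rangle$ is reversible iff each bijection $f:P\to P$ with $x\leq y\Rightarrow f(x)\leq f(y)$ for all $x,y\in P$ is an automorphism. *)

theory Defs
  imports Main
begin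

unbundle cardinal_syntax

text \<open>
  Cardinals are represented as in the HOL library: a cardinal is a relation \<open>r\<close> with
  \<^prop>\<open>Card_order r\<close>, compared by \<open>\<le>o\<close>, \<open><o\<close>, \<open>=o\<close>. The relation well-orders
  \<^term>\<open>Field r\<close>, which plays the role of the set of ordinals below the cardinal.
\<close>

definition poset_automorphism :: "'a set \<Rightarrow> ('a \<Rightarrow> 'a \<Rightarrow> bool) \<Rightarrow> ('a \<Rightarrow> 'a) \<Rightarrow> bool" where
  "poset_automorphism P le f \<longleftrightarrow>
     bij_betw f P P \<and> (\<forall>x\<in>P. \<forall>y\<in>P. le x y \<longleftrightarrow> le (f x) (f y))"

definition reversible :: "'a set \<Rightarrow> ('a \<Rightarrow> 'a \<Rightarrow> bool) \<Rightarrow> bool" where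
  "reversible P le \<longleftrightarrow>
     (\<forall>f. bij_betw f P P \<and> (\<forall>x\<in>P. \<forall>y\<in>P. le x y \<longrightarrow> le (f x) (f y))
        \<longrightarrow> poset_automorphism P le f)"

definition small_subsets :: "'a rel \<Rightarrow> 'b rel \<Rightarrow> 'a set set" where
  "small_subsets kap lam = {X. X \<subseteq> Field kap \<and> |X| <o lam}"

text \<open>
  The weak power \<open>lam\<close>-to-the-less-than-\<open>lam\<close>, as the cardinality of the set of all functions into \<open>lam\<close> whose
  domain is an ordinal below \<open>lam\<close>. The ordinals below \<open>lam\<close> are the proper initial segments
  \<^term>\<open>underS lam a\<close> with \<^prop>\<open>a \<in> Field lam\<close>. Partial maps are used instead of
  \<^const>\<open>Func\<close> so that functions with different domains are different.
\<close>

definition weak_power :: "'b rel \<Rightarrow> ('b \<rightharpoonup> 'b) rel" where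
  "weak_power lam = |\<Union>a\<in>Field lam. {f. dom f = underS lam a \<and> ran f \<subseteq> Field lam}|"

text \<open>
  HOL cannot quantify over types within a formula, so the generalized continuum hypothesis is
  stated for all infinite cardinals carried by a given type. Full GCH implies each such instance.
\<close>

definition GCH :: "'b itself \<Rightarrow> bool" where
  "GCH _ \<longleftrightarrow> (\<forall>\<mu> :: 'b rel. Card_order \<mu> \<and> cinfinite \<mu> \<longrightarrow> ctwo ^c \<mu> =o cardSuc \<mu>)"

end

theory Submission imports Defs begin

text \<open>
  Write \<open>P\<close> for the set of small subsets of \<open>lam\<close>. Both hypotheses make \<open>lam\<close> regular with
  \<open>|P| = lam\<close>, so there is an injection \<open>c\<close> from \<open>P \<times> lam\<close> into \<open>lam\<close>. To a small family \<open>x\<close> of members of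
  \<open>P\<close> assign \<open>join x\<close>, the union of \<open>x\<close> together with the codes \<open>c (b, g)\<close> for \<open>b \<in> x\<close> and \<open>g\<close> up to a stage
  that no code in the union has reached. The codes at the last stage recover \<open>x\<close>, so \<open>join\<close> is monotone
  and injective. A well-founded recursion yields \<open>G \<subseteq> P\<close> consisting of the nonempty sets that are not joins
  of families of at least two members of \<open>G\<close>. Sending \<open>{}\<close> to \<open>{}\<close>, \<open>{a}\<close> to \<open>a\<close> and all other \<open>x\<close> to
  \<open>join x\<close> is then a monotone bijection from the small subsets of \<open>G\<close> onto \<open>P\<close>. It is not an
  embedding: singletons and pairs belong to \<open>G\<close>, so some atoms get comparable images. Since \<open>|G| = lam\<close>,
  this transfers to a subset \<open>A\<close> of \<open>kap\<close> of size \<open>lam\<close>, and leaving everything outside \<open>A\<close> fixed gives the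
  required bijection for \<open>kap\<close>.
\<close>

section \<open>Sets smaller than an infinite cardinal\<close>

abbreviation small_Pow :: "'a set \<Rightarrow> 'b rel \<Rightarrow> 'a set set" where
  "small_Pow A lam \<equiv> small_subsets |A| lam"

lemma Cinfinite_Card_order: "Cinfinite lam \<Longrightarrow> Card_order lam"
  and Cinfinite_infinite: "Cinfinite lam \<Longrightarrow> infinite (Field lam)"
  by (simp_all add: cinfinite_def)

lemma Cinfinite_wo_rel: "Cinfinite lam \<Longrightarrow> wo_rel lam"
  by (simp add: card_order_on_def wo_rel_def)

lemma ordLess_subset: "|A| <o r \<Longrightarrow> B \<subseteq> A \<Longrightarrow> |B| <o r"
  using card_of_mono1 ordLeq_ordLess_trans by blast

lemma ordLess_image: "|A| <o r \<Longrightarrow> |f ` A| <o r"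
  using card_of_image ordLeq_ordLess_trans by blast

lemma ordLess_finite: "Cinfinite r \<Longrightarrow> finite A \<Longrightarrow> |A| <o r"
  by (simp add: finite_iff_ordLess_natLeq natLeq_ordLeq_cinfinite ordLess_ordLeq_trans)

lemma ordLess_Un: "Cinfinite r \<Longrightarrow> |A| <o r \<Longrightarrow> |B| <o r \<Longrightarrow> |A \<union> B| <o r"
  using card_of_Un_ordLess_infinite_Field[OF Cinfinite_infinite Cinfinite_Card_order] by blast

lemma ordLess_under:
  assumes "Cinfinite r"
  shows "|under r a| <o r"
proof (cases "a \<in> Field r")
  case True
  have "under r a \<subseteq> underS r a \<union> {a}"
    by (auto simp: under_def underS_def)
  moreover have "|underS r a \<union> {a}| <o r"
    using assms True by (intro ordLess_Un ordLess_finite card_of_underS) simp_all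
  ultimately show ?thesis by (rule ordLess_subset[rotated])
next
  case False
  then have "under r a = {}" by (auto simp: under_def Field_def)
  then show ?thesis by (simp add: ordLess_finite assms)
qed

lemma ordLess_not_Field_subset:
  assumes "Card_order r" "|A| <o r"
  shows "\<not> Field r \<subseteq> A"
proof
  assume "Field r \<subseteq> A"
  then have "|Field r| <o r" using assms(2) by (rule ordLess_subset[rotated])
  then show False using card_of_Field_ordIso[OF assms(1)] not_ordLess_ordIso by blast
qed

text \<open>By regularity, fewer than \<open>r\<close> initial segments, each smaller than
  \<open>r\<close>, cannot cover the field. A point outside all of them is strictly above
  \<open>K\<close> by totality.\<close>

lemma AboveS_small_nonempty:
  assumes r: "Cinfinite r" "regularCard r" and K: "K \<subseteq> Field r" "|K| <o r"
  shows "AboveS r K \<noteq> {}"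
proof -
  have "|\<Union>k\<in>K. under r k| <o r"
    using card_of_UNION_ordLess_infinite_Field_regularCard[OF r(2,1) K(2)] ordLess_under[OF r(1)]
    by blast
  then have "\<not> Field r \<subseteq> (\<Union>k\<in>K. under r k)"
    by (rule ordLess_not_Field_subset[OF Cinfinite_Card_order[OF r(1)]])
  then obtain u where u: "u \<in> Field r" "\<And>k. k \<in> K \<Longrightarrow> (u, k) \<notin> r"
    by (auto simp: under_def)
  have "(k, u) \<in> r \<and> u \<noteq> k" if "k \<in> K" for k
    using u(2)[OF that] u(1) that K(1) wo_rel.TOTALS[OF Cinfinite_wo_rel[OF r(1)]] by blast
  with u show ?thesis by (auto simp: AboveS_def)
qed

section \<open>Coding small families of small sets by small sets\<close>

locale regular_coding =
  fixes lam :: "'b rel" and c :: "'b set \<times> 'b \<Rightarrow> 'b"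
  assumes Cinfinite: "Cinfinite lam"
    and regular: "regularCard lam"
    and inj: "inj_on c (small_subsets lam lam \<times> Field lam)"
    and range: "c ` (small_subsets lam lam \<times> Field lam) \<subseteq> Field lam"
begin

abbreviation P :: "'b set set" where
  "P \<equiv> small_subsets lam lam"

text \<open>Every base \<open>b\<close> in \<open>P\<close> counts, not only members of a given
  family, so the stages of a join can be read off without knowing the family.\<close>

definition stages :: "'b set \<Rightarrow> 'b set" where
  "stages E = {g \<in> Field lam. \<exists>b\<in>P. c (b, g) \<in> E}"

text \<open>The least strict upper bound of the stages; regularity provides one for every
  \<open>E\<close> in \<open>P\<close>.\<close>

definition height :: "'b set \<Rightarrow> 'b" where
  "height E = wo_rel.suc lam (stages E)"

text \<open>Codes are added at all stages up to the height, not just at the height: a larger family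
  may have a larger height, and the earlier codes must survive for monotonicity.\<close>

definition join :: "'b set set \<Rightarrow> 'b set" where
  "join x = \<Union>x \<union> c ` (x \<times> under lam (height (\<Union>x)))"

lemma infinite_Field: "infinite (Field lam)"
  using Cinfinite by (simp add: cinfinite_def)

lemma wo_rel: "wo_rel lam"
  using Cinfinite by (rule Cinfinite_wo_rel)

lemma small_UN:
  assumes "|I| <o lam" and "\<And>i. i \<in> I \<Longrightarrow> |A i| <o lam"
  shows "|\<Union>i\<in>I. A i| <o lam"
  using card_of_UNION_ordLess_infinite_Field_regularCard[OF regular Cinfinite assms(1)] assms(2) by blast

lemma P_D: "E \<in> P \<Longrightarrow> E \<subseteq> Field lam" "E \<in> P \<Longrightarrow> |E| <o lam"
  by (auto simp: small_subsets_def)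

lemma P_I: "E \<subseteq> Field lam \<Longrightarrow> |E| <o lam \<Longrightarrow> E \<in> P"
  by (auto simp: small_subsets_def)

lemma stages_subset: "stages E \<subseteq> Field lam"
  by (auto simp: stages_def)

lemma code_eqD:
  assumes "c (b, g) = c (b', g')" "b \<in> P" "b' \<in> P" "g \<in> Field lam" "g' \<in> Field lam"
  shows "b = b'" "g = g'"
  using inj_onD[OF inj assms(1)] assms by auto

lemma stages_AboveS:
  assumes "E \<in> P"
  shows "AboveS lam (stages E) \<noteq> {}"
proof (rule AboveS_small_nonempty[OF Cinfinite regular stages_subset])
  \<comment> \<open>Each stage is decoded from an element of \<open>E\<close>, so there are at most
    \<open>|E|\<close> of them.\<close>
  have "stages E \<subseteq> (\<lambda>e. snd (inv_into (P \<times> Field lam) c e)) ` E"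
  proof
    fix g assume "g \<in> stages E"
    then obtain b where b: "g \<in> Field lam" "b \<in> P" "c (b, g) \<in> E"
      by (auto simp: stages_def)
    then have "snd (inv_into (P \<times> Field lam) c (c (b, g))) = g"
      using inj by (simp add: inv_into_f_f)
    then show "g \<in> (\<lambda>e. snd (inv_into (P \<times> Field lam) c e)) ` E"
      using b(3) by (metis imageI)
  qed
  then show "|stages E| <o lam"
    using ordLess_image[OF P_D(2)[OF assms]] ordLess_subset by blast
qed

lemma height_Field: "E \<in> P \<Longrightarrow> height E \<in> Field lam"
  unfolding height_def
  by (rule wo_rel.suc_inField[OF wo_rel stages_subset stages_AboveS])

lemma height_greater:
  assumes "E \<in> P" "g \<in> stages E"
  shows "(g, height E) \<in> lam" "g \<noteq> height E"
  unfolding height_def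
  using wo_rel.suc_greater[OF wo_rel stages_subset stages_AboveS[OF assms(1)] assms(2)] by auto

lemma height_mono:
  assumes "E \<subseteq> E'" "E' \<in> P"
  shows "(height E, height E') \<in> lam"
proof -
  have sub: "stages E \<subseteq> stages E'" using assms(1) by (auto simp: stages_def)
  have "height E' \<in> AboveS lam (stages E)"
    using height_greater[OF assms(2)] height_Field[OF assms(2)] sub
    by (auto simp: AboveS_def)
  then show ?thesis
    unfolding height_def[of E] by (rule wo_rel.suc_least_AboveS[OF wo_rel])
qed

lemma Union_P:
  assumes "x \<subseteq> P" "|x| <o lam"
  shows "\<Union>x \<in> P"
proof (rule P_I)
  show "\<Union>x \<subseteq> Field lam" using assms(1) P_D(1) by blast
  show "|\<Union>x| <o lam" using small_UN[OF assms(2), of "\<lambda>i. i"] assms(1) P_D(2) by auto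
qed

lemma under_subset: "under lam a \<subseteq> Field lam"
  by (auto simp: under_def Field_def)

lemma join_P:
  assumes "x \<subseteq> P" "|x| <o lam"
  shows "join x \<in> P"
proof (rule P_I)
  show "join x \<subseteq> Field lam"
    using P_D(1)[OF Union_P[OF assms]] range assms(1) under_subset
    unfolding join_def by blast
  have "c ` (x \<times> under lam (height (\<Union>x))) =
      (\<Union>b\<in>x. (\<lambda>g. c (b, g)) ` under lam (height (\<Union>x)))" by auto
  moreover have "|\<dots>| <o lam"
    using assms(2) by (rule small_UN) (rule ordLess_image[OF ordLess_under[OF Cinfinite]])
  ultimately show "|join x| <o lam"
    unfolding join_def using P_D(2)[OF Union_P[OF assms]] by (auto intro: ordLess_Un[OF Cinfinite])
qed

text \<open>Codes already in the union have stages below the height, and the added codes realise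
  every stage up to it. Hence \<open>join x\<close> determines the height of the union as its
  largest stage.\<close>

lemma stages_join:
  assumes "x \<subseteq> P" "|x| <o lam" "x \<noteq> {}"
  shows "stages (join x) = under lam (height (\<Union>x))"
proof
  show "stages (join x) \<subseteq> under lam (height (\<Union>x))"
  proof
    fix g assume "g \<in> stages (join x)"
    then obtain b where b: "g \<in> Field lam" "b \<in> P" "c (b, g) \<in> join x"
      by (auto simp: stages_def)
    from b(3) consider "c (b, g) \<in> \<Union>x" | "c (b, g) \<in> c ` (x \<times> under lam (height (\<Union>x)))"
      unfolding join_def by blast
    then show "g \<in> under lam (height (\<Union>x))"
    proof cases
      case 1
      then have "g \<in> stages (\<Union>x)" using b by (auto simp: stages_def)
      then show ?thesis using height_greater(1)[OF Union_P[OF assms(1,2)]]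
        by (simp add: under_def)
    next
      case 2
      then obtain b' g' where "c (b, g) = c (b', g')" "b' \<in> x" and g': "g' \<in> under lam (height (\<Union>x))"
        by auto
      then have "g = g'" using code_eqD(2) b assms(1) under_subset by blast
      with g' show ?thesis by simp
    qed
  qed
  show "under lam (height (\<Union>x)) \<subseteq> stages (join x)"
    using assms(1,3) under_subset unfolding stages_def join_def by blast
qed

lemma refl_height: "E \<in> P \<Longrightarrow> height E \<in> under lam (height E)"
  using height_Field wo_rel.REFL[OF wo_rel] by (auto simp: under_def refl_on_def)

text \<open>No code at stage \<open>height (\<Union>x)\<close> lies in the union, so those in the
  join are added ones, and injectivity of \<open>c\<close> returns their bases.\<close>

lemma join_code_iff:
  assumes "x \<subseteq> P" "|x| <o lam" "b \<in> P"
  shows "c (b, height (\<Union>x)) \<in> join x \<longleftrightarrow> b \<in> x"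
proof
  let ?h = "height (\<Union>x)"
  have U: "\<Union>x \<in> P" using Union_P[OF assms(1,2)] .
  assume "c (b, ?h) \<in> join x"
  moreover have "c (b, ?h) \<notin> \<Union>x"
    using height_greater(2)[OF U, of ?h] height_Field[OF U] assms(3) by (auto simp: stages_def)
  ultimately obtain b' g where "c (b, ?h) = c (b', g)" and b': "b' \<in> x" and "g \<in> under lam ?h"
    unfolding join_def by auto
  then have "b = b'" using code_eqD(1) assms height_Field[OF U] under_subset by blast
  with b' show "b \<in> x" by simp
next
  assume "b \<in> x"
  then show "c (b, height (\<Union>x)) \<in> join x"
    using refl_height[OF Union_P[OF assms(1,2)]] by (auto simp: join_def)
qed

lemma join_inj:
  assumes x: "x \<subseteq> P" "|x| <o lam" "x \<noteq> {}" and y: "y \<subseteq> P" "|y| <o lam" "y \<noteq> {}"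
    and eq: "join x = join y"
  shows "x = y"
proof -
  have "under lam (height (\<Union>x)) = under lam (height (\<Union>y))"
    using stages_join[OF x] stages_join[OF y] eq by simp
  then have "height (\<Union>x) = height (\<Union>y)"
    using refl_height[OF Union_P[OF x(1,2)]] refl_height[OF Union_P[OF y(1,2)]]
      wo_rel.ANTISYM[OF wo_rel]
    unfolding under_def by (auto dest: antisymD)
  then have "b \<in> x \<longleftrightarrow> b \<in> y" if "b \<in> P" for b
    using join_code_iff[OF x(1,2) that] join_code_iff[OF y(1,2) that] eq by simp
  with x y show ?thesis by blast
qed

text \<open>A join is strictly higher than each of its members; this makes recursion over joins
  well-founded.\<close>

lemma height_join:
  assumes "x \<subseteq> P" "|x| <o lam" "E \<in> x"
  shows "(height E, height (join x)) \<in> lam - Id"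
proof -
  have 1: "(height E, height (\<Union>x)) \<in> lam"
    using assms(3) by (intro height_mono Union_P[OF assms(1,2)]) auto
  have "height (\<Union>x) \<in> stages (join x)"
    using stages_join[OF assms(1,2)] refl_height[OF Union_P[OF assms(1,2)]] assms(3) by auto
  note 2 = height_greater[OF join_P[OF assms(1,2)] this]
  show ?thesis
    using 1 2 wo_rel.TRANS[OF wo_rel] wo_rel.ANTISYM[OF wo_rel]
    by (metis DiffI antisymD pair_in_Id_conv transD)
qed

text \<open>
  The top codes of two members of \<open>x\<close> are distinct and lie outside the nonempty union of \<open>x\<close>, so a join
  of at least two sets has at least three elements. For \<open>e = e'\<close> the lemma excludes singletons.
\<close>

lemma join_not_pair:
  assumes "x \<subseteq> P" "|x| <o lam" "a \<in> x" "b \<in> x" "a \<noteq> b"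
  shows "join x \<noteq> {e, e'}"
proof
  assume eq: "join x = {e, e'}"
  let ?h = "height (\<Union>x)"
  have U: "\<Union>x \<in> P" using Union_P[OF assms(1,2)] .
  have ab: "a \<in> P" "b \<in> P" using assms by auto
  have "c (a, ?h) \<in> join x" "c (b, ?h) \<in> join x"
    using join_code_iff[OF assms(1,2)] ab assms by auto
  moreover have "c (a, ?h) \<noteq> c (b, ?h)"
    using code_eqD(1) ab assms(5) height_Field[OF U] by blast
  ultimately have "join x = {c (a, ?h), c (b, ?h)}" using eq by auto
  moreover have "c (a, ?h) \<notin> \<Union>x" "c (b, ?h) \<notin> \<Union>x"
    using height_greater(2)[OF U, of ?h] height_Field[OF U] ab by (auto simp: stages_def)
  moreover have "\<Union>x \<subseteq> join x" by (simp add: join_def)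
  ultimately have "\<Union>x = {}" by auto
  then show False using assms(3-5) by auto
qed

section \<open>The kernel of the join operation and the bijection built on it\<close>

lemma join_kernel_exists:
  obtains G where "G \<subseteq> P"
    and "\<And>y. y \<in> P \<Longrightarrow>
      y \<in> G \<longleftrightarrow> y \<noteq> {} \<and> (\<forall>x\<subseteq>G. |x| <o lam \<longrightarrow> y = join x \<longrightarrow> (\<exists>a. x \<subseteq> {a}))"
proof -
  define R where "R = inv_image (lam - Id) height"
  have wf: "wf R"
    unfolding R_def using wo_rel.WF[OF wo_rel] by blast
  \<comment> \<open>The clause \<open>(E, y) \<in> R\<close> lets \<open>\<Phi>\<close> consult
    \<open>g\<close> only below \<open>y\<close>, as the recursion equation requires. It costs
    nothing in the end, since members of a family always lie below its join.\<close>
  define \<Phi> where "\<Phi> = (\<lambda>g y. y \<in> P \<and> y \<noteq> {} \<and>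
    (\<forall>x. (\<forall>E\<in>x. E \<in> P \<and> (E, y) \<in> R \<and> g E) \<longrightarrow> |x| <o lam \<longrightarrow> y = join x \<longrightarrow> (\<exists>a. x \<subseteq> {a})))"
  define g where "g = wfrec R \<Phi>"
  have "g y = \<Phi> (cut g R y) y" for y
    unfolding g_def by (rule wfrec[OF wf])
  moreover have "\<Phi> (cut g R y) y = \<Phi> g y" for y
    unfolding \<Phi>_def by (simp add: cut_apply cong: conj_cong)
  ultimately have g: "g y \<longleftrightarrow> \<Phi> g y" for y by simp
  have sub: "Collect g \<subseteq> P"
    using g by (auto simp: \<Phi>_def)
  have inR: "\<forall>E\<in>x. (E, join x) \<in> R" if "x \<subseteq> Collect g" "|x| <o lam" for x
    using height_join[of x] that sub by (auto simp: R_def)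
  show thesis
  proof (rule that[of "Collect g"])
    show "Collect g \<subseteq> P" by (fact sub)
    fix y assume y: "y \<in> P"
    have "(\<forall>E\<in>x. E \<in> P \<and> (E, y) \<in> R \<and> g E) \<longleftrightarrow> x \<subseteq> Collect g" if "|x| <o lam" "y = join x" for x
      using inR[of x] that sub by auto
    then show "y \<in> Collect g \<longleftrightarrow>
        y \<noteq> {} \<and> (\<forall>x\<subseteq>Collect g. |x| <o lam \<longrightarrow> y = join x \<longrightarrow> (\<exists>a. x \<subseteq> {a}))"
      using g[of y] y unfolding \<Phi>_def by (metis mem_Collect_eq)
  qed
qed

text \<open>The two directions of the characterisation of \<open>G\<close> do the work: members of
  \<open>G\<close> are not joins of families with two or more members of \<open>G\<close>, so the
  two branches of \<open>F\<close> do not collide; nonempty sets outside \<open>G\<close> are such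
  joins, so \<open>F\<close> is onto.\<close>

lemma exists_monotone_bijection:
  obtains G :: "'b set set" and F where "|G| =o lam"
    and "bij_betw F (small_Pow G lam) P"
    and "\<And>x y. y \<in> small_Pow G lam \<Longrightarrow> x \<subseteq> y \<Longrightarrow> F x \<subseteq> F y"
    and "\<exists>x\<in>small_Pow G lam. \<exists>y\<in>small_Pow G lam. F x \<subseteq> F y \<and> \<not> x \<subseteq> y"
proof -
  obtain G where GP: "G \<subseteq> P" and G: "\<And>y. y \<in> P \<Longrightarrow>
      y \<in> G \<longleftrightarrow> y \<noteq> {} \<and> (\<forall>x\<subseteq>G. |x| <o lam \<longrightarrow> y = join x \<longrightarrow> (\<exists>a. x \<subseteq> {a}))"
    using join_kernel_exists by metis
  let ?S = "small_Pow G lam"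
  have S: "x \<in> ?S \<longleftrightarrow> x \<subseteq> G \<and> |x| <o lam" for x
    by (simp add: small_subsets_def Field_card_of)
  \<comment> \<open>The case \<open>e = e'\<close> puts singletons into \<open>G\<close>, which also
    gives \<open>G\<close> at least \<open>lam\<close> members.\<close>
  have pair: "{e, e'} \<in> G" if "e \<in> Field lam" "e' \<in> Field lam" for e e'
  proof -
    have "{e, e'} \<in> P" using that by (intro P_I ordLess_finite[OF Cinfinite]) auto
    moreover have "\<exists>a. x \<subseteq> {a}" if "x \<subseteq> G" "|x| <o lam" "{e, e'} = join x" for x
    proof (rule ccontr)
      assume "\<not> (\<exists>a. x \<subseteq> {a})"
      then have "x \<noteq> {}" "\<And>a. \<not> x \<subseteq> {a}" by auto
      then obtain a b where "a \<in> x" "b \<in> x" "a \<noteq> b" by blast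
      with join_not_pair[of x a b e e'] that GP show False by auto
    qed
    ultimately show ?thesis using G by blast
  qed
  \<comment> \<open>The union branch covers both \<open>{}\<close>, sent to \<open>{}\<close>, and
    \<open>{a}\<close>, sent to \<open>a\<close>.\<close>
  define F where "F = (\<lambda>x. if \<exists>a. x \<subseteq> {a} then \<Union>x else join x)"
  have F_join: "F x = join x" if "\<not> (\<exists>a. x \<subseteq> {a})" for x using that by (simp add: F_def)
  have F_empty: "F {} = {}" by (simp add: F_def)
  have F_single: "F {a} = a" for a by (auto simp: F_def)
  have GE: "\<And>y. y \<in> G \<Longrightarrow> y \<noteq> {}" using G GP by blast
  \<comment> \<open>The formula \<open>{F x} - {{}}\<close> inverts \<open>F\<close> uniformly on
    the empty family and on singletons, because members of \<open>G\<close> are nonempty.\<close>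
  have few_F: "F x = {} \<or> F x \<in> G" "x = {F x} - {{}}" if "x \<in> ?S" "\<exists>a. x \<subseteq> {a}" for x
  proof -
    have "x = {} \<or> (\<exists>a\<in>G. x = {a})"
      using that unfolding S subset_singleton_iff by auto
    then show "F x = {} \<or> F x \<in> G" "x = {F x} - {{}}"
      using GE F_empty by (auto simp: F_single)
  qed
  have join_G: "join x \<notin> G" "join x \<noteq> {}" if "x \<in> ?S" "\<not> (\<exists>a. x \<subseteq> {a})" for x
  proof -
    have x: "x \<subseteq> G" "|x| <o lam" "x \<subseteq> P" using that S GP by auto
    show "join x \<notin> G" using G[OF join_P[OF x(3,2)]] x that(2) by blast
    from that(2) obtain a where "a \<in> x" by blast
    then show "join x \<noteq> {}" using GE[of a] x(1) unfolding join_def by auto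
  qed
  have mono: "F x \<subseteq> F y" if "x \<subseteq> y" "y \<in> ?S" for x y
  proof (cases "\<exists>a. x \<subseteq> {a}")
    case True
    then have "F x = \<Union>x" by (simp add: F_def)
    moreover have "\<Union>y \<subseteq> F y" by (simp add: F_def join_def)
    ultimately show ?thesis using that(1) by blast
  next
    case False
    then have "\<not> (\<exists>a. y \<subseteq> {a})" using that(1) by blast
    moreover have "join x \<subseteq> join y"
    proof -
      have y: "y \<subseteq> P" "|y| <o lam" using that(2) S GP by auto
      have "(height (\<Union>x), height (\<Union>y)) \<in> lam"
        using that(1) by (intro height_mono Union_P[OF y]) auto
      then have "under lam (height (\<Union>x)) \<subseteq> under lam (height (\<Union>y))"
        using wo_rel.TRANS[OF wo_rel] by (auto simp: under_def dest: transD)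
      then show ?thesis using that(1) unfolding join_def by blast
    qed
    ultimately show ?thesis using False by (simp add: F_join)
  qed
  have bij: "bij_betw F ?S P"
  proof (rule bij_betw_imageI)
    show "inj_on F ?S"
    proof (rule inj_onI)
      fix x y assume xy: "x \<in> ?S" "y \<in> ?S" "F x = F y"
      show "x = y"
      proof (cases "\<exists>a. x \<subseteq> {a}")
        case few_x: True
        have "\<exists>a. y \<subseteq> {a}"
        proof (rule ccontr)
          assume few_y: "\<not> (\<exists>a. y \<subseteq> {a})"
          show False
            using few_F(1)[OF xy(1) few_x] join_G[OF xy(2) few_y] xy(3) F_join[OF few_y] by simp
        qed
        then show ?thesis
          using few_F(2)[OF xy(1) few_x] few_F(2)[OF xy(2)] xy(3) by simp
      next
        case few_x: False
        have few_y: "\<not> (\<exists>a. y \<subseteq> {a})"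
        proof
          assume few_y: "\<exists>a. y \<subseteq> {a}"
          show False
            using few_F(1)[OF xy(2) few_y] join_G[OF xy(1) few_x] xy(3) F_join[OF few_x] by simp
        qed
        have "x \<noteq> {}" "y \<noteq> {}" using few_x few_y by auto
        moreover have "x \<subseteq> P" "|x| <o lam" "y \<subseteq> P" "|y| <o lam" using xy(1,2) S GP by auto
        moreover have "join x = join y" using xy(3) F_join[OF few_x] F_join[OF few_y] by simp
        ultimately show ?thesis by (intro join_inj)
      qed
    qed
    show "F ` ?S = P"
    proof
      show "F ` ?S \<subseteq> P"
        using Union_P join_P S GP by (auto simp: F_def)
      show "P \<subseteq> F ` ?S"
      proof
        fix y assume y: "y \<in> P"
        have sm: "{} \<in> ?S" "\<And>a. a \<in> G \<Longrightarrow> {a} \<in> ?S" by (simp_all add: S ordLess_finite[OF Cinfinite])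
        consider "y = {}" | "y \<in> G" | x where "x \<subseteq> G" "|x| <o lam" "y = join x" "\<not> (\<exists>a. x \<subseteq> {a})"
          using G[OF y] by blast
        then show "y \<in> F ` ?S"
        proof cases
          case 1
          then show ?thesis using F_empty sm(1) by (metis imageI)
        next
          case 2
          then show ?thesis using F_single sm(2) by (metis imageI)
        next
          case (3 x)
          then show ?thesis using F_join S by (metis imageI)
        qed
      qed
    qed
  qed
  obtain e where e: "e \<in> Field lam" using infinite_imp_nonempty[OF infinite_Field] by blast
  obtain e' where e': "e' \<in> Field lam" "e' \<noteq> e"
    using infinite_imp_nonempty[OF infinite_remove[OF infinite_Field, of e]] by blast
  have "{{e}} \<in> ?S" "{{e, e'}} \<in> ?S"
    using pair[OF e e] pair[OF e e'(1)] by (simp_all add: S ordLess_finite[OF Cinfinite])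
  moreover have "F {{e}} \<subseteq> F {{e, e'}}" by (simp add: F_single)
  moreover have "\<not> {{e}} \<subseteq> {{e, e'}}" using e'(2) by auto
  ultimately have ex: "\<exists>x\<in>?S. \<exists>y\<in>?S. F x \<subseteq> F y \<and> \<not> x \<subseteq> y" by blast
  have "inj_on (\<lambda>E. c (E, e)) G"
    \<comment> \<open>With the stage fixed at \<open>e\<close>, coding is injective in the
      base.\<close>
    using code_eqD(1) GP e by (intro inj_onI) blast
  moreover have "(\<lambda>E. c (E, e)) ` G \<subseteq> Field lam" using range GP e by blast
  ultimately have "|G| \<le>o |Field lam|" using card_of_ordLeq by blast
  moreover have "|Field lam| \<le>o |G|"
    using pair[of e e for e] by (intro card_of_ordLeqI[of "\<lambda>e. {e}"]) (simp_all add: inj_on_def)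
  ultimately have "|G| =o |Field lam|" by (simp add: ordIso_iff_ordLeq)
  then have "|G| =o lam"
    using card_of_Field_ordIso[OF Cinfinite_Card_order[OF Cinfinite]] by (rule ordIso_transitive)
  from that[OF this bij mono ex] show thesis by blast
qed

end

section \<open>Transfer to the small subsets of a larger cardinal\<close>

lemma bij_betw_small_subsets:
  assumes "bij_betw j A B"
  shows "bij_betw (image j) (small_Pow A lam) (small_Pow B lam)"
proof (rule bij_betw_imageI)
  have inj: "inj_on j A" and img: "j ` A = B" using assms by (auto simp: bij_betw_def)
  show "inj_on (image j) (small_Pow A lam)"
    using inj_on_image_eq_iff[OF inj] by (intro inj_onI) (auto simp: small_subsets_def Field_card_of)
  show "image j ` small_Pow A lam = small_Pow B lam"
  proof
    show "image j ` small_Pow A lam \<subseteq> small_Pow B lam"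
      using img ordLess_image by (auto simp: small_subsets_def Field_card_of)
    show "small_Pow B lam \<subseteq> image j ` small_Pow A lam"
    proof
      fix Y assume "Y \<in> small_Pow B lam"
      then have Y: "Y \<subseteq> j ` A" "|Y| <o lam" by (auto simp: small_subsets_def Field_card_of img)
      have "j ` inv_into A j ` Y = Y" using Y(1) by (rule image_inv_into_cancel[OF refl])
      moreover have "inv_into A j ` Y \<in> small_Pow A lam"
        using Y inv_into_into[of _ j A] ordLess_image[OF Y(2)]
        by (auto simp: small_subsets_def Field_card_of)
      ultimately show "Y \<in> image j ` small_Pow A lam" by (metis imageI)
    qed
  qed
qed

text \<open>A set splits into its trace on \<open>A\<close> and the rest. Applying \<open>H\<close>
  to the trace and the identity to the rest keeps bijectivity and monotonicity, and on subsets of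
  \<open>A\<close> it is \<open>H\<close> itself, so the failure of reflection persists.\<close>

lemma not_reversible_small_subsets_extend:
  assumes lam: "Cinfinite lam" and A: "A \<subseteq> Field kap"
    and bij: "bij_betw H (small_Pow A lam) (small_Pow A lam)"
    and mono: "\<And>x y. y \<in> small_Pow A lam \<Longrightarrow> x \<subseteq> y \<Longrightarrow> H x \<subseteq> H y"
    and nonrefl: "x0 \<in> small_Pow A lam" "y0 \<in> small_Pow A lam" "H x0 \<subseteq> H y0" "\<not> x0 \<subseteq> y0"
  shows "\<not> reversible (small_subsets kap lam) (\<subseteq>)"
proof
  assume rev: "reversible (small_subsets kap lam) (\<subseteq>)"
  let ?S = "small_Pow A lam" and ?T = "small_subsets kap lam"
  define f where "f X = H (X \<inter> A) \<union> (X - A)" for X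
  have S: "x \<in> ?S \<longleftrightarrow> x \<subseteq> A \<and> |x| <o lam" for x
    by (simp add: small_subsets_def Field_card_of)
  have T: "x \<in> ?T \<longleftrightarrow> x \<subseteq> Field kap \<and> |x| <o lam" for x
    by (simp add: small_subsets_def)
  have TS: "X \<inter> A \<in> ?S" if "X \<in> ?T" for X
    using that ordLess_subset[of X lam "X \<inter> A"] by (auto simp: S T)
  have HS: "H x \<in> ?S" if "x \<in> ?S" for x
    using bij that by (auto simp: bij_betw_def)
  have combine: "x \<union> (X - A) \<in> ?T" if "x \<in> ?S" "X \<in> ?T" for x X
    using that A ordLess_Un[OF lam] ordLess_subset[of X lam "X - A"] unfolding S T by blast
  have f_Int: "f X \<inter> A = H (X \<inter> A)" and f_Diff: "f X - A = X - A" if "X \<in> ?T" for X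
    using HS[OF TS[OF that]] by (auto simp: f_def S)
  have "bij_betw f ?T ?T"
  proof (rule bij_betw_imageI)
    show "inj_on f ?T"
    proof (rule inj_onI)
      fix X Y assume XY: "X \<in> ?T" "Y \<in> ?T" "f X = f Y"
      then have "H (X \<inter> A) = H (Y \<inter> A)" "X - A = Y - A"
        using f_Int f_Diff by metis+
      moreover from this have "X \<inter> A = Y \<inter> A"
        using bij TS XY by (auto simp: bij_betw_def dest: inj_onD)
      ultimately show "X = Y" by blast
    qed
    show "f ` ?T = ?T"
    proof
      show "f ` ?T \<subseteq> ?T"
        using combine HS TS by (auto simp: f_def)
      show "?T \<subseteq> f ` ?T"
      proof
        fix Y assume Y: "Y \<in> ?T"
        obtain x where x: "x \<in> ?S" "H x = Y \<inter> A"
          using bij TS[OF Y] by (metis bij_betw_imp_surj_on imageE)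
        have "(x \<union> (Y - A)) \<inter> A = x" "x \<union> (Y - A) - A = Y - A" using x(1) S by auto
        then have "f (x \<union> (Y - A)) = Y" using x(2) by (auto simp: f_def)
        with combine[OF x(1) Y] show "Y \<in> f ` ?T" by (metis imageI)
      qed
    qed
  qed
  moreover have "f X \<subseteq> f Y" if "X \<in> ?T" "Y \<in> ?T" "X \<subseteq> Y" for X Y
    using mono[OF TS[OF that(2)], of "X \<inter> A"] that(3) unfolding f_def by blast
  ultimately have "poset_automorphism ?T (\<subseteq>) f"
    using rev unfolding reversible_def by simp
  moreover have "x0 \<in> ?T" "y0 \<in> ?T" using nonrefl A S T by auto
  moreover have "f x = H x" if "x \<in> ?S" for x
  proof -
    have "x \<inter> A = x" "x - A = {}" using that S by auto
    then show ?thesis by (simp only: f_def Un_empty_right)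
  qed
  then have "f x0 \<subseteq> f y0" using nonrefl by simp
  ultimately show False using nonrefl(4) by (auto simp: poset_automorphism_def)
qed

lemma not_reversible_small_subsets:
  fixes lam :: "'b rel" and kap :: "'a rel"
  assumes lam: "Cinfinite lam" "regularCard lam" and P: "|small_subsets lam lam| \<le>o lam"
    and kap: "lam \<le>o kap"
  shows "\<not> reversible (small_subsets kap lam) (\<subseteq>)"
proof -
  have lam_Field: "|Field lam| =o lam"
    using lam(1) by (intro card_of_Field_ordIso) simp
  have "|small_subsets lam lam \<times> Field lam| \<le>o lam"
    using lam(1) P lam_Field
    by (intro card_of_Times_ordLeq_infinite_Field) (auto simp: cinfinite_def ordIso_iff_ordLeq)
  also have "lam \<le>o |Field lam|" using lam_Field by (simp add: ordIso_iff_ordLeq)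
  finally obtain c :: "'b set \<times> 'b \<Rightarrow> 'b" where
    "inj_on c (small_subsets lam lam \<times> Field lam)" "c ` (small_subsets lam lam \<times> Field lam) \<subseteq> Field lam"
    by (auto simp flip: card_of_ordLeq)
  then interpret regular_coding lam c
    using lam by unfold_locales
  obtain G :: "'b set set" and F where G: "|G| =o lam"
    and F: "bij_betw F (small_Pow G lam) P"
    and mono: "\<And>x y. y \<in> small_Pow G lam \<Longrightarrow> x \<subseteq> y \<Longrightarrow> F x \<subseteq> F y"
    and nonrefl: "\<exists>x\<in>small_Pow G lam. \<exists>y\<in>small_Pow G lam. F x \<subseteq> F y \<and> \<not> x \<subseteq> y"
    using exists_monotone_bijection by blast
  have "|Field lam| \<le>o |Field kap|" using kap by (rule card_of_mono2)
  then obtain i where i: "inj_on i (Field lam)" "i ` Field lam \<subseteq> Field kap"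
    by (auto simp flip: card_of_ordLeq)
  define A where "A = i ` Field lam"
  have iA: "bij_betw i (Field lam) A" using i by (simp add: A_def bij_betw_def)
  have "|G| =o |Field lam|" using G lam_Field ordIso_symmetric ordIso_transitive by blast
  then obtain j where "bij_betw j G (Field lam)" by (auto simp flip: card_of_ordIso)
  then have "bij_betw (i \<circ> j) G A" using iA by (rule bij_betw_trans)
  then have jA: "bij_betw (inv_into G (i \<circ> j)) A G" by (rule bij_betw_inv_into)
  define k where "k = inv_into G (i \<circ> j)"
  let ?S = "small_Pow A lam"
  have k: "bij_betw (image k) ?S (small_Pow G lam)"
    unfolding k_def using jA by (rule bij_betw_small_subsets)
  have "small_Pow (Field lam) lam = P" by (simp add: small_subsets_def Field_card_of)
  then have i': "bij_betw (image i) P ?S" using bij_betw_small_subsets[OF iA, of lam] by simp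
  \<comment> \<open>\<open>k\<close> relabels subsets of \<open>A\<close> as families in
    \<open>G\<close>, \<open>F\<close> turns these into subsets of \<open>lam\<close>, and
    \<open>i\<close> copies the result back into \<open>A\<close>.\<close>
  define H where "H = image i \<circ> (F \<circ> image k)"
  have H: "bij_betw H ?S ?S"
    unfolding H_def using k F i' by (intro bij_betw_trans)
  have Hmono: "H x \<subseteq> H y" if "y \<in> ?S" "x \<subseteq> y" for x y
    using mono[of "k ` y" "k ` x"] bij_betwE[OF k] that by (auto simp: H_def)
  obtain u v where uv: "u \<in> small_Pow G lam" "v \<in> small_Pow G lam" "F u \<subseteq> F v" "\<not> u \<subseteq> v"
    using nonrefl by blast
  obtain x where x: "x \<in> ?S" "u = k ` x"
    using uv(1) unfolding bij_betw_imp_surj_on[OF k, symmetric] by (rule imageE)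
  obtain y where y: "y \<in> ?S" "v = k ` y"
    using uv(2) unfolding bij_betw_imp_surj_on[OF k, symmetric] by (rule imageE)
  show ?thesis
  proof (rule not_reversible_small_subsets_extend[OF lam(1) _ H Hmono x(1) y(1)])
    show "A \<subseteq> Field kap" using i(2) by (simp add: A_def)
    show "H x \<subseteq> H y" using uv(3) x y by (auto simp: H_def)
    show "\<not> x \<subseteq> y" using uv(4) x y by auto
  qed
qed

section \<open>Regularity and the bound on the number of small subsets\<close>

text \<open>A set smaller than \<open>lam\<close> is equipotent to a proper initial segment, so it
  is the range of a map counted by the weak power.\<close>

lemma small_subsets_ordLeq_weak_power:
  assumes "Card_order lam"
  shows "|small_subsets lam lam| \<le>o weak_power lam"
proof -
  let ?W = "\<Union>a\<in>Field lam. {f. dom f = underS lam a \<and> ran f \<subseteq> Field lam}"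
  have wo: "Well_order lam" using assms by (simp add: card_order_on_def)
  have "small_subsets lam lam \<subseteq> ran ` ?W"
  proof
    fix X assume "X \<in> small_subsets lam lam"
    then have X: "X \<subseteq> Field lam" "|X| <o lam" by (auto simp: small_subsets_def)
    obtain a where a: "a \<in> Field lam" "|X| =o Restr lam (underS lam a)"
      using ordLess_iff_ordIso_Restr[OF wo card_of_Well_order] X(2) by blast
    have "Field (Restr lam (underS lam a)) = underS lam a"
      using wo wo_rel.underS_ofilter Field_Restr_ofilter unfolding wo_rel_def by fastforce
    then have "|X| =o |underS lam a|" using card_of_cong[OF a(2)] by (simp add: Field_card_of)
    then have "|underS lam a| =o |X|" by (rule ordIso_symmetric)
    then obtain h where h: "bij_betw h (underS lam a) X"
      by (auto simp flip: card_of_ordIso)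
    define f where "f = (\<lambda>u. if u \<in> underS lam a then Some (h u) else None)"
    have "dom f = underS lam a" by (auto simp: f_def split: if_splits)
    moreover have "ran f = X" using h by (auto simp: f_def ran_def bij_betw_def)
    ultimately have "f \<in> ?W" "X = ran f" using a(1) X(1) by auto
    then show "X \<in> ran ` ?W" by blast
  qed
  then show ?thesis unfolding weak_power_def by (rule surj_imp_ordLeq)
qed

text \<open>
  Koenig's diagonal argument: if \<open>K\<close> were small and cofinal, the graph of a function on \<open>K\<close> that avoids
  at \<open>a\<close> the values of all graphs enumerated up to \<open>a\<close> would be missing from the enumeration.
\<close>

lemma regularCard_if_small_subsets_ordLeq:
  assumes lam: "Cinfinite lam" and P: "|small_subsets lam lam| \<le>o lam"
  shows "regularCard lam"
  unfolding regularCard_def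
proof (intro allI impI, rule ccontr)
  fix K assume K: "K \<subseteq> Field lam \<and> cofinal K lam" and ne: "\<not> |K| =o lam"
  have co: "Card_order lam" and inf: "infinite (Field lam)" using lam by (auto simp: cinfinite_def)
  have lam_Field: "|Field lam| =o lam" using co by (rule card_of_Field_ordIso)
  have "|K| \<le>o lam"
    using card_of_mono1[of K "Field lam"] K lam_Field ordLeq_ordIso_trans by blast
  then have Kl: "|K| <o lam" using ne ordLeq_iff_ordLess_or_ordIso by blast
  have "|small_subsets lam lam| \<le>o |Field lam|"
    using P lam_Field ordIso_symmetric ordLeq_ordIso_trans by blast
  then obtain e where e: "inj_on e (small_subsets lam lam)" "e ` small_subsets lam lam \<subseteq> Field lam"
    by (auto simp flip: card_of_ordLeq)
  have "|Field lam \<times> Field lam| =o |Field lam|" using inf by (rule card_of_Times_same_infinite)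
  then obtain p where p: "bij_betw p (Field lam \<times> Field lam) (Field lam)"
    by (auto simp flip: card_of_ordIso)
  \<comment> \<open>The value at \<open>a\<close> of the graph that \<open>X\<close> codes through
    \<open>p\<close>. If there is none or it is not unique, the choice is arbitrary, which only adds
    a harmless value to avoid.\<close>
  define val where "val a X = (SOME v. v \<in> Field lam \<and> p (a, v) \<in> X)" for a X
  have "\<exists>v\<in>Field lam. v \<notin> (\<lambda>u. val a (inv_into (small_subsets lam lam) e u)) ` under lam a" for a
    using ordLess_not_Field_subset[OF co ordLess_image[OF ordLess_under[OF lam]]] by blast
  then obtain d where d: "\<And>a. d a \<in> Field lam"
    "\<And>a. d a \<notin> (\<lambda>u. val a (inv_into (small_subsets lam lam) e u)) ` under lam a"
    by metis
  define D where "D = (\<lambda>a. p (a, d a)) ` K"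
  have "D \<subseteq> Field lam" using p d(1) K by (auto simp: D_def bij_betw_def)
  then have DP: "D \<in> small_subsets lam lam"
    using ordLess_image[OF Kl] by (auto simp: D_def small_subsets_def)
  then have "e D \<in> Field lam" using e(2) by blast
  \<comment> \<open>Cofinality places the index of \<open>D\<close> below some \<open>a\<close> in
    \<open>K\<close>, so \<open>d a\<close> was chosen to avoid the value of \<open>D\<close> at
    \<open>a\<close>, which is \<open>d a\<close>.\<close>
  then obtain a where a: "a \<in> K" "(e D, a) \<in> lam" using K by (auto simp: cofinal_def)
  have "v = d a" if "v \<in> Field lam" "p (a, v) \<in> D" for v
  proof -
    from that(2) obtain b where b: "b \<in> K" "p (a, v) = p (b, d b)" by (auto simp: D_def)
    then have "(a, v) = (b, d b)"
      using p that(1) a(1) K d(1) by (auto simp: bij_betw_def dest!: inj_onD)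
    then show ?thesis by simp
  qed
  moreover have "d a \<in> Field lam \<and> p (a, d a) \<in> D" using d(1) a(1) by (simp add: D_def)
  ultimately have "val a D = d a" unfolding val_def by (rule_tac some_equality) auto
  moreover have "inv_into (small_subsets lam lam) e (e D) = D" using e(1) DP by (rule inv_into_f_f)
  ultimately have "d a \<in> (\<lambda>u. val a (inv_into (small_subsets lam lam) e u)) ` under lam a"
    using a(2) by (intro image_eqI[of _ _ "e D"]) (auto simp: under_def)
  with d(2) show False by blast
qed

text \<open>By regularity every small set is bounded, hence lies in one of \<open>lam\<close> many
  power sets of initial segments. Under GCH each of these has size at most
  \<open>lam\<close>.\<close>

lemma GCH_small_subsets_ordLeq:
  fixes lam :: "'b rel"
  assumes lam: "Cinfinite lam" "regularCard lam" and gch: "GCH TYPE('b)"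
  shows "|small_subsets lam lam| \<le>o lam"
proof -
  have co: "Card_order lam" and inf: "infinite (Field lam)" using lam(1) by (auto simp: cinfinite_def)
  have "small_subsets lam lam \<subseteq> (\<Union>a\<in>Field lam. Pow (under lam a))"
  proof
    fix X assume "X \<in> small_subsets lam lam"
    then have "AboveS lam X \<noteq> {}"
      by (intro AboveS_small_nonempty[OF lam]) (auto simp: small_subsets_def)
    then show "X \<in> (\<Union>a\<in>Field lam. Pow (under lam a))"
      by (auto simp: AboveS_def under_def)
  qed
  then have "|small_subsets lam lam| \<le>o |\<Union>a\<in>Field lam. Pow (under lam a)|" by (rule card_of_mono1)
  also have "|\<Union>a\<in>Field lam. Pow (under lam a)| \<le>o lam"
  proof (rule card_of_UNION_ordLeq_infinite_Field[OF inf co])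
    show "|Field lam| \<le>o lam" using card_of_Field_ordIso[OF co] by (simp add: ordIso_iff_ordLeq)
    show "\<forall>a\<in>Field lam. |Pow (under lam a)| \<le>o lam"
    proof
      fix a
      show "|Pow (under lam a)| \<le>o lam"
      \<comment> \<open>GCH speaks only of infinite cardinals, so finite segments are treated
        apart.\<close>
      proof (cases "finite (under lam a)")
        case True
        then show ?thesis
          by (intro ordLess_imp_ordLeq ordLess_finite[OF lam(1)]) simp
      next
        case False
        have "|Pow (under lam a)| =o ctwo ^c |under lam a|"
          unfolding cexp_def ctwo_def Field_card_of by (rule card_of_Pow_Func)
        also have "ctwo ^c |under lam a| =o cardSuc |under lam a|"
          using gch[unfolded GCH_def, rule_format, of "|under lam a|"] False
          by (simp add: cinfinite_def Field_card_of card_of_card_order_on)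
        also have "cardSuc |under lam a| \<le>o lam"
          using ordLess_under[OF lam(1)] cardSuc_ordLess_ordLeq[OF card_of_Card_order co] by blast
        finally show ?thesis .
      qed
    qed
  qed
  finally show ?thesis .
qed

text \<open>Both parts reduce to regularity and at most \<open>lam\<close> small subsets: the weak
  power yields the bound and thereby regularity, while regularity together with GCH yields the
  bound.\<close>

theorem proposition6p4:
  fixes lam :: "'b rel" and kap :: "'a rel"
  assumes "Card_order lam" and "Card_order kap"
  shows "(natLeq \<le>o lam \<and> lam =o weak_power lam \<and> lam \<le>o kap
            \<longrightarrow> \<not> reversible (small_subsets kap lam) (\<subseteq>))
       \<and> (GCH TYPE('b) \<longrightarrow> natLeq \<le>o lam \<and> lam \<le>o kap \<and> regularCard lam
            \<longrightarrow> \<not> reversible (small_subsets kap lam) (\<subseteq>))"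
proof (intro conjI impI; elim conjE)
  assume "natLeq \<le>o lam" and weak: "lam =o weak_power lam" and kap: "lam \<le>o kap"
  from this(1) have lam: "Cinfinite lam"
    using assms(1) natLeq_cinfinite cinfinite_mono by blast
  have "|small_subsets lam lam| \<le>o lam"
    using small_subsets_ordLeq_weak_power[OF assms(1)] weak ordIso_symmetric ordLeq_ordIso_trans by blast
  with lam kap show "\<not> reversible (small_subsets kap lam) (\<subseteq>)"
    using regularCard_if_small_subsets_ordLeq not_reversible_small_subsets by blast
next
  assume "natLeq \<le>o lam" and kap: "lam \<le>o kap" and "regularCard lam" and "GCH TYPE('b)"
  moreover from this have "Cinfinite lam"
    using assms(1) natLeq_cinfinite cinfinite_mono by blast
  ultimately show "\<not> reversible (small_subsets kap lam) (\<subseteq>)"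
    using GCH_small_subsets_ordLeq not_reversible_small_subsets by blast
qed

end
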